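(* Let $(X,\sigma)$ be a Deaconu-Renault system with $X$ a metric space and such that $\mathrm{Dom}(\sigma)$ is dense in $X$. If $(X,\sigma)$ has the shadowing property, then it has the finite shadowing property.
   Context: A Deaconu-Renault system is a pair $(X,\sigma)$ consisting of a locally compact Hausdorff space $X$ and a local homeomorphism $\sigma:\mathrm{Dom}(\sigma)\to\mathrm{Im}(\sigma)$ from an open set $\mathrm{Dom}(\sigma)\subseteq X$ onto an open set $\mathrm{Im}(\sigma)\subseteq X$; inductively $\mathrm{Dom}(\sigma^n)=\sigma^{-1}(\mathrm{Dom}(\sigma^{n-1}))$, with $\sigma^0=\mathrm{id}_X$. When $X$ is a metric space, its topology is the one induced by the metric $d$. A (finite) $\delta$-chain is an infinite sequence $(x_i)_{i=1}^\infty$ (respectively a finite sequence $(x_i)_{i=1}^k$) in $X$ such that $x_i\in\mathrm{Dom}(\sigma)$ and $d(\sigma(x_i),x_{i+1})<\delta$ for all $i$ (respectively for all $1\le i<k$; the last term need not be in $\mathrm{Dom}(\sigma)$). A point $x\in X$ $\varepsilon$-shadows a finite or infinite sequence $(y_i)_{i\ge1}$ if, for all indices $i$, $x\in\mathrm{Dom}(\sigma^{i-1})$ and $d(\sigma^{i-1}(x),y_i)<\varepsilon$. The system has the (finite) shadowing property if for every $\varepsilon>0$ there is $\delta>0$ such that every infinite (respectively every finite) $\delta$-chain is $\varepsilon$-shadowed by some $x\in X$. *)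

theory Defs
  imports "HOL-Analysis.Analysis"
begin

definition local_homeomorphism_map ::
    "'a topology \<Rightarrow> 'b topology \<Rightarrow> ('a \<Rightarrow> 'b) \<Rightarrow> bool" where
  "local_homeomorphism_map X Y f \<longleftrightarrow>
     f \<in> topspace X \<rightarrow> topspace Y \<and>
     (\<forall>x\<in>topspace X. \<exists>U V. openin X U \<and> x \<in> U \<and> openin Y V \<and>
        homeomorphic_map (subtopology X U) (subtopology Y V) f)"

text \<open>
  A partial map on \<open>X\<close> is represented by its domain \<open>D\<close> and a total function \<open>\<sigma>\<close>
  whose values outside \<open>D\<close> are irrelevant; its image is \<open>\<sigma> ` D\<close>.
\<close>

locale deaconu_renault =
  fixes X :: "'a topology" and D :: "'a set" and \<sigma> :: "'a \<Rightarrow> 'a"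
  assumes locally_compact: "locally_compact_space X"
    and Hausdorff: "Hausdorff_space X"
    and open_Dom: "openin X D"
    and open_Im: "openin X (\<sigma> ` D)"
    and local_homeo:
      "local_homeomorphism_map (subtopology X D) (subtopology X (\<sigma> ` D)) \<sigma>"

fun Dom_iter :: "'a set \<Rightarrow> 'a set \<Rightarrow> ('a \<Rightarrow> 'a) \<Rightarrow> nat \<Rightarrow> 'a set" where
  "Dom_iter M D \<sigma> 0 = M"
| "Dom_iter M D \<sigma> (Suc n) = {x \<in> D. \<sigma> x \<in> Dom_iter M D \<sigma> n}"

text \<open>
  Sequences are indexed from 0, so the \<open>i\<close>-th term is compared with the \<open>i\<close>-th iterate.
  Finite sequences are nonempty lists; a one-term sequence is always a finite chain.
\<close>

definition chain ::
    "'a set \<Rightarrow> ('a \<Rightarrow> 'a \<Rightarrow> real) \<Rightarrow> 'a set \<Rightarrow> ('a \<Rightarrow> 'a) \<Rightarrow> real \<Rightarrow> (nat \<Rightarrow> 'a) \<Rightarrow> bool" where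
  "chain M d D \<sigma> \<delta> x \<longleftrightarrow>
     (\<forall>i. x i \<in> M) \<and> (\<forall>i. x i \<in> D \<and> d (\<sigma> (x i)) (x (Suc i)) < \<delta>)"

definition finite_chain ::
    "'a set \<Rightarrow> ('a \<Rightarrow> 'a \<Rightarrow> real) \<Rightarrow> 'a set \<Rightarrow> ('a \<Rightarrow> 'a) \<Rightarrow> real \<Rightarrow> 'a list \<Rightarrow> bool" where
  "finite_chain M d D \<sigma> \<delta> xs \<longleftrightarrow>
     xs \<noteq> [] \<and> set xs \<subseteq> M \<and>
     (\<forall>i. Suc i < length xs \<longrightarrow> xs ! i \<in> D \<and> d (\<sigma> (xs ! i)) (xs ! Suc i) < \<delta>)"

text \<open>The index set \<open>I\<close> is \<open>UNIV\<close> for infinite sequences, \<open>{..<k}\<close> for those of length \<open>k\<close>.\<close>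

definition shadows ::
    "'a set \<Rightarrow> ('a \<Rightarrow> 'a \<Rightarrow> real) \<Rightarrow> 'a set \<Rightarrow> ('a \<Rightarrow> 'a) \<Rightarrow> real \<Rightarrow> 'a \<Rightarrow> nat set \<Rightarrow> (nat \<Rightarrow> 'a) \<Rightarrow> bool"
  where
  "shadows M d D \<sigma> \<epsilon> x I y \<longleftrightarrow>
     (\<forall>i\<in>I. x \<in> Dom_iter M D \<sigma> i \<and> d ((\<sigma> ^^ i) x) (y i) < \<epsilon>)"

definition shadowing_property ::
    "'a set \<Rightarrow> ('a \<Rightarrow> 'a \<Rightarrow> real) \<Rightarrow> 'a set \<Rightarrow> ('a \<Rightarrow> 'a) \<Rightarrow> bool" where
  "shadowing_property M d D \<sigma> \<longleftrightarrow>
     (\<forall>\<epsilon>>0. \<exists>\<delta>>0. \<forall>y. chain M d D \<sigma> \<delta> y \<longrightarrow>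
        (\<exists>x\<in>M. shadows M d D \<sigma> \<epsilon> x UNIV y))"

definition finite_shadowing_property ::
    "'a set \<Rightarrow> ('a \<Rightarrow> 'a \<Rightarrow> real) \<Rightarrow> 'a set \<Rightarrow> ('a \<Rightarrow> 'a) \<Rightarrow> bool" where
  "finite_shadowing_property M d D \<sigma> \<longleftrightarrow>
     (\<forall>\<epsilon>>0. \<exists>\<delta>>0. \<forall>ys. finite_chain M d D \<sigma> \<delta> ys \<longrightarrow>
        (\<exists>x\<in>M. shadows M d D \<sigma> \<epsilon> x {..<length ys} (\<lambda>i. ys ! i)))"

end

theory Submission
  imports Defs
begin

text \<open>
  Moving the last term of a finite \<open>\<delta>\<close>-chain slightly into the dense set \<open>D\<close> keeps it a
  \<open>\<delta>\<close>-chain, because the chain inequalities are strict. Since \<open>\<sigma>\<close> maps \<open>D\<close> into the closure of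
  \<open>D\<close>, the modified chain can be continued inside \<open>D\<close> forever; a point that \<open>\<epsilon>/2\<close>-shadows the
  resulting infinite chain \<open>\<epsilon>\<close>-shadows the original one.
\<close>

context Metric_space
begin

lemma dense_approx:
  assumes "mtopology closure_of D = M" "x \<in> M" "0 < r"
  obtains y where "y \<in> D" "y \<in> M" "d x y < r"
proof -
  have "x \<in> mtopology closure_of D"
    using assms by simp
  then show thesis
    using assms(3) that by (auto simp: metric_closure_of in_mball)
qed

text \<open>Each \<open>\<sigma> x\<close> with \<open>x \<in> D\<close> lies in \<open>M\<close>,
  so density provides a point of \<open>D\<close> within \<open>\<delta>\<close> of it. Iterating
  such a choice from \<open>w\<close> never leaves \<open>D\<close>.\<close>

lemma chain_starting_in_dense_domain:
  assumes dense: "mtopology closure_of D = M"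
    and maps: "\<sigma> ` D \<subseteq> M" and DM: "D \<subseteq> M"
    and "0 < \<delta>" "w \<in> D"
  obtains z where "chain M d D \<sigma> \<delta> z" "z 0 = w"
proof -
  have "\<exists>y. y \<in> D \<and> d (\<sigma> x) y < \<delta>" if "x \<in> D" for x
    using dense_approx[OF dense _ \<open>0 < \<delta>\<close>, of "\<sigma> x"] maps that by blast
  then obtain g where g: "\<And>x. x \<in> D \<Longrightarrow> g x \<in> D \<and> d (\<sigma> x) (g x) < \<delta>"
    by metis
  define z where "z i = (g ^^ i) w" for i
  have "z i \<in> D" for i
    by (induction i) (auto simp: z_def g \<open>w \<in> D\<close>)
  then have "chain M d D \<sigma> \<delta> z"
    using g DM by (auto simp: chain_def z_def)
  then show thesis
    using that by (simp add: z_def)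
qed

lemma finite_chain_extends_to_chain:
  assumes dense: "mtopology closure_of D = M"
    and maps: "\<sigma> ` D \<subseteq> M" and DM: "D \<subseteq> M"
    and "0 < \<delta>" "0 < r" and ys: "finite_chain M d D \<sigma> \<delta> ys"
  obtains z where "chain M d D \<sigma> \<delta> z" "\<And>i. i < length ys \<Longrightarrow> d (z i) (ys ! i) < r"
proof -
  define n where "n = length ys - 1"
  have len: "length ys = Suc n"
    using ys by (cases ys) (auto simp: finite_chain_def n_def)
  have ysM: "ys ! i \<in> M" if "i \<le> n" for i
    using ys that len by (auto simp: finite_chain_def)
  have step: "ys ! i \<in> D" "d (\<sigma> (ys ! i)) (ys ! Suc i) < \<delta>" if "i < n" for i
    using ys that len by (auto simp: finite_chain_def)
  \<comment> \<open>The tolerance for moving the last term: at most \<open>r\<close>, and at most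
    the slack in the final chain inequality. For \<open>n = 0\<close> no term precedes it, so there
    is no inequality to preserve.\<close>
  define s where "s = (if n = 0 then r else min r (\<delta> - d (\<sigma> (ys ! (n - 1))) (ys ! n)))"
  have "0 < s"
    using step(2)[of "n - 1"] \<open>0 < r\<close> by (auto simp: s_def)
  then obtain w where w: "w \<in> D" "w \<in> M" "d (ys ! n) w < s"
    using dense_approx[OF dense ysM[of n]] by blast
  have wr: "d w (ys ! n) < r"
    using w(3) by (auto simp: s_def commute split: if_splits)
  have joint: "d (\<sigma> (ys ! (n - 1))) w < \<delta>" if "0 < n"
  proof -
    have "\<sigma> (ys ! (n - 1)) \<in> M"
      using step(1)[of "n - 1"] maps that by auto
    then have "d (\<sigma> (ys ! (n - 1))) w \<le> d (\<sigma> (ys ! (n - 1))) (ys ! n) + d (ys ! n) w"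
      using w(2) ysM by (intro triangle) auto
    then show ?thesis
      using w(3) that by (auto simp: s_def)
  qed
  obtain u where u: "chain M d D \<sigma> \<delta> u" "u 0 = w"
    using chain_starting_in_dense_domain[OF dense maps DM \<open>0 < \<delta>\<close> w(1)] .
  \<comment> \<open>The term \<open>ys ! n\<close>, which may lie outside \<open>D\<close>, is
    dropped: index \<open>n\<close> now carries \<open>u 0 = w\<close>.\<close>
  define z where "z i = (if i < n then ys ! i else u (i - n))" for i
  have "z i \<in> M \<and> z i \<in> D \<and> d (\<sigma> (z i)) (z (Suc i)) < \<delta>" for i
  proof -
    \<comment> \<open>A step inside the old chain, the step into \<open>w\<close> (covered by
      \<open>joint\<close>), or a step inside \<open>u\<close>.\<close>
    consider "Suc i < n" | "Suc i = n" | "n \<le> i"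
      by linarith
    then show ?thesis
    proof cases
      case 1
      then show ?thesis
        using step[of i] ysM[of i] by (simp add: z_def)
    next
      case 2
      then show ?thesis
        using step(1)[of i] ysM[of i] joint u(2) by (auto simp: z_def)
    next
      case 3
      then show ?thesis
        using u(1) by (simp add: z_def chain_def Suc_diff_le)
    qed
  qed
  then have "chain M d D \<sigma> \<delta> z"
    by (simp add: chain_def)
  moreover have "d (z i) (ys ! i) < r" if "i < length ys" for i
  proof (cases "i = n")
    case True
    then show ?thesis
      using wr u(2) by (simp add: z_def)
  next
    case False
    then show ?thesis
      using that len ysM[of i] \<open>0 < r\<close> by (simp add: z_def)
  qed
  ultimately show thesis
    using that by blast
qed

text \<open>The triangle inequality holds only for points of \<open>M\<close>, so the iterates of
  the shadowing point must be located there.\<close>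

lemma Dom_iter_funpow_in_carrier:
  assumes "\<sigma> ` D \<subseteq> M" "x \<in> M" "x \<in> Dom_iter M D \<sigma> i"
  shows "(\<sigma> ^^ i) x \<in> M"
  using assms(2,3)
\<comment> \<open>\<open>Dom_iter\<close> peels off the first application of \<sigma>,
  \<open>funpow\<close> the last one. Hence the hypothesis is applied to \<open>\<sigma> x\<close>,
  after commuting \<sigma> past its iterate.\<close>
proof (induction i arbitrary: x)
  case (Suc i)
  then show ?case
    using assms(1) by (auto simp: funpow_swap1)
qed simp

end

theorem proposition2p7:
  fixes M :: "'a set" and d :: "'a \<Rightarrow> 'a \<Rightarrow> real"
    and D :: "'a set" and \<sigma> :: "'a \<Rightarrow> 'a"
  assumes "Metric_space M d"
    and "deaconu_renault (Metric_space.mtopology M d) D \<sigma>"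
    and "Metric_space.mtopology M d closure_of D = M"
    and "shadowing_property M d D \<sigma>"
  shows "finite_shadowing_property M d D \<sigma>"
  unfolding finite_shadowing_property_def
proof (intro allI impI)
  interpret Metric_space M d by fact
  interpret deaconu_renault mtopology D \<sigma> by fact
  have DM: "D \<subseteq> M" and maps: "\<sigma> ` D \<subseteq> M"
    using openin_subset[OF open_Dom] openin_subset[OF open_Im] by auto
  fix \<epsilon> :: real
  assume "0 < \<epsilon>"
  \<comment> \<open>One half is spent on shadowing the extended chain, the other on its distance
    from \<open>ys\<close>. The extension is again a \<delta>-chain, so the same \<delta> serves for
    finite chains.\<close>
  then have half: "0 < \<epsilon> / 2" by simp
  then obtain \<delta> where "0 < \<delta>"
    and \<delta>: "\<And>y. chain M d D \<sigma> \<delta> y \<Longrightarrow> \<exists>x\<in>M. shadows M d D \<sigma> (\<epsilon> / 2) x UNIV y"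
    using assms(4) unfolding shadowing_property_def by meson
  have "\<exists>x\<in>M. shadows M d D \<sigma> \<epsilon> x {..<length ys} ((!) ys)"
    if ys: "finite_chain M d D \<sigma> \<delta> ys" for ys
  proof -
    obtain z where z: "chain M d D \<sigma> \<delta> z"
      and close: "\<And>i. i < length ys \<Longrightarrow> d (z i) (ys ! i) < \<epsilon> / 2"
      using finite_chain_extends_to_chain[OF assms(3) maps DM \<open>0 < \<delta>\<close> half ys] by blast
    obtain x where "x \<in> M" and x: "shadows M d D \<sigma> (\<epsilon> / 2) x UNIV z"
      using \<delta>[OF z] by blast
    have "x \<in> Dom_iter M D \<sigma> i \<and> d ((\<sigma> ^^ i) x) (ys ! i) < \<epsilon>" if i: "i < length ys" for i
    proof -
      have dom: "x \<in> Dom_iter M D \<sigma> i" and near: "d ((\<sigma> ^^ i) x) (z i) < \<epsilon> / 2"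
        using x by (auto simp: shadows_def)
      have "(\<sigma> ^^ i) x \<in> M"
        using Dom_iter_funpow_in_carrier[OF maps \<open>x \<in> M\<close> dom] .
      moreover have "z i \<in> M" "ys ! i \<in> M"
        using z ys i by (auto simp: chain_def finite_chain_def)
      ultimately have "d ((\<sigma> ^^ i) x) (ys ! i) \<le> d ((\<sigma> ^^ i) x) (z i) + d (z i) (ys ! i)"
        by (rule triangle)
      then show ?thesis
        using dom near close[OF i] by simp
    qed
    then show ?thesis
      using \<open>x \<in> M\<close> by (auto simp: shadows_def)
  qed
  then show "\<exists>\<delta>>0. \<forall>ys. finite_chain M d D \<sigma> \<delta> ys \<longrightarrow>
      (\<exists>x\<in>M. shadows M d D \<sigma> \<epsilon> x {..<length ys} ((!) ys))"
    using \<open>0 < \<delta>\<close> by blast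
qed

end
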